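(* Let $V$ be a vector space over a field and let $W$ be a subspace of $V$. The semigroup $\overline{L}(V,W)$ is unit-regular if and only if both of the following hold: (i) $W$ is trivial, i.e. $W=\{0\}$ or $W=V$; (ii) $V$ is finite-dimensional.
   Context: Maps are written on the right and composed from left to right. $L(V)$ is the semigroup of all linear maps $V\to V$ under composition, and $\overline{L}(V,W)=\{f\in L(V) : Wf\subseteq W\}$, a subsemigroup containing the identity. A semigroup $S$ with identity is unit-regular if for every $s\in S$ there is a unit $u$ of $S$ with $sus=s$. *)

theory Defs
  imports Complex_Main "HOL-Algebra.Group"
begin

text \<open>
  The vector space \<open>V\<close> is the whole type \<^typ>\<open>'v\<close> with scalar multiplication \<open>scale\<close>.
  Maps act on the right, so the product \<open>f \<otimes> g\<close> is ``first \<open>f\<close>, then \<open>g\<close>''.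
\<close>

definition linear_maps :: "('k::field \<Rightarrow> 'v::ab_group_add \<Rightarrow> 'v) \<Rightarrow> ('v \<Rightarrow> 'v) monoid" where
  "linear_maps scale =
     \<lparr>carrier = {f. Vector_Spaces.linear scale scale f}, mult = (\<lambda>f g. g \<circ> f), one = id\<rparr>"

definition preserving_linear_maps ::
    "('k::field \<Rightarrow> 'v::ab_group_add \<Rightarrow> 'v) \<Rightarrow> 'v set \<Rightarrow> ('v \<Rightarrow> 'v) monoid" where
  "preserving_linear_maps scale W =
     (linear_maps scale)\<lparr>carrier := {f \<in> carrier (linear_maps scale). f ` W \<subseteq> W}\<rparr>"

definition unit_regular :: "('a, 'b) monoid_scheme \<Rightarrow> bool" where
  "unit_regular S \<longleftrightarrow>
     (\<forall>s \<in> carrier S. \<exists>u \<in> Units S. s \<otimes>\<^bsub>S\<^esub> u \<otimes>\<^bsub>S\<^esub> s = s)"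

text \<open>The locale \<^locale>\<open>finite_dimensional_vector_space\<close> takes a finite basis as a parameter.\<close>

definition finite_dimensional :: "('k::field \<Rightarrow> 'v::ab_group_add \<Rightarrow> 'v) \<Rightarrow> bool" where
  "finite_dimensional scale \<longleftrightarrow> (\<exists>B. finite_dimensional_vector_space scale B)"

lemma monoid_linear_maps:
  assumes "vector_space scale"
  shows "monoid (linear_maps scale)"
  using assms
  by (auto simp: linear_maps_def monoid_def o_assoc
      intro: Vector_Spaces.linear_compose vector_space.linear_id)

lemma submonoid_preserving_linear_maps:
  assumes "vector_space scale"
  shows "submonoid (carrier (preserving_linear_maps scale W)) (linear_maps scale)"
  using assms
  by (auto simp: preserving_linear_maps_def linear_maps_def submonoid_def
      intro: Vector_Spaces.linear_compose vector_space.linear_id)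

lemma monoid_preserving_linear_maps:
  assumes "vector_space scale"
  shows "monoid (preserving_linear_maps scale W)"
  using submonoid.submonoid_is_monoid[OF submonoid_preserving_linear_maps[OF assms]
      monoid_linear_maps[OF assms]]
  by (simp add: preserving_linear_maps_def)

end

theory Submission
  imports Defs
begin

text \<open>
  An inner inverse of a nonzero map \<open>f\<close> with \<open>W f = 0\<close> and \<open>V f \<subseteq> W\<close> cannot preserve \<open>W\<close>, so
  regularity already forces \<open>W\<close> to be trivial. An injective map \<open>f\<close> with \<open>f u f = f\<close> satisfies
  \<open>f u = 1\<close>, so it is invertible if \<open>u\<close> is; but an infinite-dimensional space has an injective
  endomorphism that is not surjective. Conversely, a linear map of a finite-dimensional space has
  a linear section over its range, and this section extends from the range to an automorphism.
\<close>

lemma carrier_preserving_linear_maps: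
  "carrier (preserving_linear_maps scale W) = {f. Vector_Spaces.linear scale scale f \<and> f ` W \<subseteq> W}"
  by (auto simp: preserving_linear_maps_def linear_maps_def)

lemma mult_preserving_linear_maps:
  "f \<otimes>\<^bsub>preserving_linear_maps scale W\<^esub> g = g \<circ> f"
  by (simp add: preserving_linear_maps_def linear_maps_def)

lemma one_preserving_linear_maps:
  "\<one>\<^bsub>preserving_linear_maps scale W\<^esub> = id"
  by (simp add: preserving_linear_maps_def linear_maps_def)

lemmas preserving_linear_maps_simps =
  carrier_preserving_linear_maps mult_preserving_linear_maps one_preserving_linear_maps

text \<open>For trivial \<open>W\<close> the monoid therefore consists of all linear maps, so
  membership only has to be checked for linearity.\<close>

lemma preserves_trivial_subspace:
  assumes "Vector_Spaces.linear scale scale f" and "W = {0} \<or> W = UNIV"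
  shows "f ` W \<subseteq> W"
proof -
  interpret Vector_Spaces.linear scale scale f by fact
  show ?thesis using assms(2) by auto
qed

context vector_space
begin

text \<open>A basis of \<open>W\<close> stays independent when a vector \<open>v\<close> outside
  \<open>W\<close> is adjoined. Sending that basis to 0 and \<open>v\<close> to a nonzero
  \<open>w\<close> in \<open>W\<close> extends linearly.\<close>

lemma exists_nonzero_linear_map_into_and_vanishing_on_subspace:
  assumes "subspace W" and "W \<noteq> {0}" and "W \<noteq> UNIV"
  obtains f v where "Vector_Spaces.linear scale scale f" and "range f \<subseteq> W"
    and "\<And>x. x \<in> W \<Longrightarrow> f x = 0" and "f v \<noteq> 0"
proof -
  interpret vector_space_pair scale scale ..
  obtain w where w: "w \<in> W" "w \<noteq> 0"
    using subspace_0 assms(1,2) by blast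
  obtain v where v: "v \<notin> W" using assms(3) by blast
  obtain B where B: "B \<subseteq> W" "independent B" "W \<subseteq> span B"
    by (rule maximal_independent_subset)
  have spanB: "span B = W" using B assms(1) by (simp add: span_subspace)
  then have ind: "independent (insert v B)"
    using v B(2) by (simp add: independent_insertI)
  define f where "f = construct (insert v B) (\<lambda>b. if b = v then w else 0)"
  have lin: "Vector_Spaces.linear scale scale f"
    unfolding f_def by (rule linear_construct[OF ind])
  have "f b = 0" if "b \<in> B" for b
    using that v B(1) construct_basis[OF ind] unfolding f_def by auto
  then have "f x = 0" if "x \<in> W" for x
    using that linear_eq_0_on_span[OF lin] spanB by blast
  moreover have "f v \<noteq> 0"
    using construct_basis[OF ind] w unfolding f_def by simp
  \<comment> \<open>\<open>construct\<close> sends the basis vectors beyond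
    \<open>insert v B\<close> to 0, so the range is spanned by 0 and \<open>w\<close> alone.\<close>
  moreover have "range f \<subseteq> W"
    unfolding f_def range_construct_eq_span[OF ind]
    using w assms(1) by (intro span_minimal) (auto simp: subspace_0)
  ultimately show thesis using that lin by blast
qed

text \<open>An infinite basis is in bijection with itself minus one vector, and the linear extension
  of such a bijection is a shift that misses the removed vector.\<close>

lemma exists_inj_not_surj_linear_map:
  assumes "\<not> finite_dimensional scale"
  obtains f where "Vector_Spaces.linear scale scale f" and "inj f" and "\<not> surj f"
proof -
  interpret vector_space_pair scale scale ..
  obtain B where B: "independent B" "span B = UNIV"
    using independent_extend_basis[OF independent_empty] span_extend_basis[OF independent_empty]
    by blast
  have "infinite B"
  proof
    assume "finite B"
    then have "finite_dimensional_vector_space scale B"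
      using B by unfold_locales
    with assms show False unfolding finite_dimensional_def by blast
  qed
  then obtain b where b: "b \<in> B" using infinite_imp_nonempty by blast
  obtain h where h: "bij_betw h B (B - {b})"
    using infinite_imp_bij_betw[OF \<open>infinite B\<close>] by blast
  define f where "f = construct B h"
  have lin: "Vector_Spaces.linear scale scale f"
    unfolding f_def by (rule linear_construct[OF B(1)])
  have fh: "f c = h c" if "c \<in> B" for c
    using that construct_basis[OF B(1)] unfolding f_def by simp
  have img: "f ` B = B - {b}"
    using fh bij_betw_imp_surj_on[OF h] by (metis image_cong)
  have "inj_on f B"
    using fh bij_betw_imp_inj_on[OF h] by (metis inj_on_cong)
  moreover have "independent (f ` B)"
    unfolding img using B(1) by (rule independent_mono) blast
  ultimately have "inj f"
    using linear_inj_on_span_independent_image[OF lin] B(2) by metis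
  \<comment> \<open>The range is the span of \<open>B - {b}\<close>, which cannot contain
    \<open>b\<close> because \<open>B\<close> is independent.\<close>
  moreover have "b \<notin> range f"
    using linear_span_image[OF lin, of B] img B b dependent_def by metis
  ultimately show thesis using that lin by blast
qed

end

lemma (in finite_dimensional_vector_space) exists_bij_linear_inner_inverse:
  assumes "Vector_Spaces.linear scale scale f"
  obtains u where "Vector_Spaces.linear scale scale u" and "bij u" and "f \<circ> u \<circ> f = f"
proof -
  interpret vector_space_pair scale scale ..
  obtain g where lin_g: "Vector_Spaces.linear scale scale g" and fg: "\<And>x. f (g (f x)) = f x"
    using linear_exists_right_inverse_on[OF assms subspace_UNIV] by auto
  obtain C where C: "C \<subseteq> range f" "independent C" "range f \<subseteq> span C"
    by (rule maximal_independent_subset)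
  have spanC: "span C = range f"
    using C linear_subspace_image[OF assms subspace_UNIV] by (simp add: span_subspace)
  \<comment> \<open>On the range of \<open>f\<close> the map \<open>g\<close> is undone by
    \<open>f\<close>.\<close>
  have "inj_on g (span C)"
    unfolding spanC by (rule inj_on_inverseI[of _ f]) (auto simp: fg)
  then have "independent (g ` C)" and "inj_on g C"
    using linear_independent_injective_image[OF lin_g C(2)] inj_on_subset span_superset by blast+
  \<comment> \<open>Finite dimension matters here: the spans of \<open>C\<close> and of its image
    under \<open>g\<close> have complements of equal dimension, so \<open>g\<close> on
    \<open>C\<close> extends to an injective map of the whole space.\<close>
  then obtain u where u: "Vector_Spaces.linear scale scale u" "inj u" "\<forall>x\<in>C. u x = g x"
    using linear_independent_extend_inj[OF C(2)] by blast
  have "u (f x) = g (f x)" for x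
    using linear_eq_on[OF u(1) lin_g] u(3) C(3) by blast
  then have "f \<circ> u \<circ> f = f" by (simp add: fun_eq_iff fg)
  moreover have "bij u" using u linear_inj_imp_surj by (simp add: bij_def)
  ultimately show thesis using that u(1) by blast
qed

theorem theorem4p11:
  fixes scale :: "'k::field \<Rightarrow> 'v::ab_group_add \<Rightarrow> 'v" and W :: "'v set"
  assumes "vector_space scale"
    and "module.subspace scale W"
  shows "unit_regular (preserving_linear_maps scale W) \<longleftrightarrow>
           (W = {0} \<or> W = UNIV) \<and> finite_dimensional scale"
proof -
  interpret vector_space scale by fact
  let ?S = "preserving_linear_maps scale W"
  show ?thesis
  proof
    assume reg: "unit_regular ?S"
    have inner: "\<exists>u \<in> Units ?S. f \<circ> (u \<circ> f) = f"
      if "Vector_Spaces.linear scale scale f" "f ` W \<subseteq> W" for f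
      using reg that unfolding unit_regular_def preserving_linear_maps_simps by blast
    have W: "W = {0} \<or> W = UNIV"
    proof (rule ccontr)
      assume "\<not> ?thesis"
      then obtain f v where f: "Vector_Spaces.linear scale scale f" "range f \<subseteq> W"
          "\<And>x. x \<in> W \<Longrightarrow> f x = 0" "f v \<noteq> 0"
        using exists_nonzero_linear_map_into_and_vanishing_on_subspace assms(2) by blast
      then obtain u where u: "u \<in> Units ?S" "f \<circ> (u \<circ> f) = f"
        using inner[of f] by blast
      \<comment> \<open>The vector \<open>f v\<close> lies in \<open>W\<close> and the unit
        \<open>u\<close> preserves \<open>W\<close>, where \<open>f\<close> vanishes.\<close>
      then have "u (f v) \<in> W"
        using f(2) by (auto simp: Units_def preserving_linear_maps_simps)
      then have "f (u (f v)) = 0" by (rule f(3))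
      then show False using u(2) f(4) by (metis comp_apply)
    qed
    moreover have "finite_dimensional scale"
    proof (rule ccontr)
      assume "\<not> ?thesis"
      then obtain f where f: "Vector_Spaces.linear scale scale f" "inj f" "\<not> surj f"
        by (rule exists_inj_not_surj_linear_map)
      \<comment> \<open>Triviality of \<open>W\<close>, already proved, is what puts
        \<open>f\<close> into \<open>?S\<close>.\<close>
      then obtain u where u: "u \<in> Units ?S" "f \<circ> (u \<circ> f) = f"
        using inner preserves_trivial_subspace[OF _ W] by blast
      have "u (f x) = x" for x
        using u(2) f(2) by (metis comp_apply injD)
      \<comment> \<open>Composing \<open>u \<circ> f = id\<close> with the inverse \<open>v\<close>
        of \<open>u\<close> gives \<open>f = v\<close>, so \<open>f\<close> would be
        surjective.\<close>
      moreover obtain v where "v \<circ> u = id" "u \<circ> v = id"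
        using u(1) by (auto simp: Units_def preserving_linear_maps_simps)
      ultimately have "f (u x) = x" for x by (metis comp_apply id_apply)
      then show False using f(3) by (metis surjI)
    qed
    ultimately show "(W = {0} \<or> W = UNIV) \<and> finite_dimensional scale" ..
  next
    assume R: "(W = {0} \<or> W = UNIV) \<and> finite_dimensional scale"
    then obtain B where "finite_dimensional_vector_space scale B"
      unfolding finite_dimensional_def by blast
    then interpret finite_dimensional_vector_space scale B .
    have carrier: "f \<in> carrier ?S \<longleftrightarrow> Vector_Spaces.linear scale scale f" for f
      using R preserves_trivial_subspace unfolding carrier_preserving_linear_maps by blast
    show "unit_regular ?S"
      unfolding unit_regular_def
    proof
      fix f assume "f \<in> carrier ?S"
      then have "Vector_Spaces.linear scale scale f" using carrier by simp
      then obtain u where u: "Vector_Spaces.linear scale scale u" "bij u" "f \<circ> u \<circ> f = f"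
        by (rule exists_bij_linear_inner_inverse)
      \<comment> \<open>The inverse of \<open>u\<close> must lie in \<open>?S\<close> too; by
        \<open>carrier\<close> its linearity suffices.\<close>
      then have "Vector_Spaces.linear scale scale (inv_into UNIV u)"
        using inj_linear_imp_inv_linear bij_is_inj by blast
      moreover have "inv_into UNIV u \<circ> u = id" "u \<circ> inv_into UNIV u = id"
        using u(2) by (simp_all add: bij_is_inj bij_is_surj surj_iff[THEN iffD1])
      ultimately have "u \<in> Units ?S"
        using u(1) unfolding Units_def
        by (auto simp: carrier mult_preserving_linear_maps one_preserving_linear_maps)
      then show "\<exists>u \<in> Units ?S. f \<otimes>\<^bsub>?S\<^esub> u \<otimes>\<^bsub>?S\<^esub> f = f"
        using u(3) by (auto simp: mult_preserving_linear_maps o_assoc)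
    qed
  qed
qed

end
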